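(* Let $X,Y,Z$ be dichotomous ($\pm1$-valued) random variables such that the pairs $X-Y$, $X-Z$ and $Y-Z$ are jointly measurable, with given joint probability distributions $p_{X;Y}$, $p_{X;Z}$, $p_{Y;Z}$ on $\{\pm1\}^2$. Suppose that the indistinguishability relations $X_Y\equiv X_Z$, $Y_X\equiv Y_Z$ and $Z_X\equiv Z_Y$ are satisfied. Then there exists a signed probability space $(\Omega,\mathcal{F},\mu)$, with extended random variables representing $X,Y,Z$ defined on it, for which each of the jointly measurable pairs $\{X,Y\}$, $\{X,Z\}$, $\{Y,Z\}$ is a $\mu$-induced context (the probability measure of each context giving the pair its prescribed joint distribution).
   Context: Jointly measurable pair: a pair $X-Y$ is jointly measurable when it comes with a classical joint probability distribution $p_{X;Y}$ of its outcomes (here a probability measure on $\{\pm1\}^2$). No joint distribution of all the variables together is assumed. Notation $X_Y$: the random variable $X$ considered in the context of the joint measurement $X-Y$; similarly $X_Z$, $Y_X$, $Y_Z$, $Z_X$, $Z_Y$. Indistinguishability relation $\equiv$: $X_Y\equiv X_Z$ means that the two versions of $X$ can be identified as random variables, i.e. each proposition about $X$ has the same probability in both contexts: $\sum_{b}p_{X;Y}(X=a,Y=b)=\sum_{c}p_{X;Z}(X=a,Z=c)$ for $a=\pm1$; similarly for the other variables. Signed measure: for a set $\Omega$ and a $\sigma$-algebra $\mathcal{F}$ on $\Omega$, a signed measure is a function $\mu:\mathcal{F}\to\mathbb{R}$ with $\mu(\emptyset)=0$ and $\mu(\bigcup_i A_i)=\sum_i\mu(A_i)$ for every countable pairwise disjoint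 family $\{A_i\}_{i\in\mathbb{N}}\subseteq\mathcal{F}$. The triple $(\Omega,\mathcal{F},\mu)$ is called a signed measure space. Extended random variable: given a signed measure space $(\Omega,\mathcal{F},\mu)$ and a Borel space $(M,\mathcal{M})$ with $M\subseteq\mathbb{R}$, a (real-valued) extended random variable is a measurable function $R^*:\Omega\to M$. $\mu$-induced context: let $\{R^*_i\}_{i=1,\dots,n}$ be a collection of extended random variables on a signed measure space $(\Omega,\mathcal{F},\mu)$. A $\mu$-induced context is a subset $C^\mu_j=\{R^*_k\}_{k\in N_j}$, $N_j\subset\{1,\dots,n\}$, for which there exists a sub-$\sigma$-algebra $\mathcal{F}_j$ of $\mathcal{F}$ such that, setting $p^\mu_j(F):=\mu(F)$ for all $F\in\mathcal{F}_j$, the triple $(\Omega,\mathcal{F}_j,p^\mu_j)$ is a probability space and, for every $k\in N_j$, $R^*_k$ is a random variable on it (i.e. is $\mathcal{F}_j$-measurable). Signed (or negative) probability space: a signed measure space $(\Omega,\mathcal{F},\mu)$ endowed with a non-empty set of contexts (in the sense just defined) and such that $\mu(\Omega)=1$. *)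

theory Defs
  imports "HOL-Probability.Probability"
begin

definition signed_measure_space :: "'w set \<Rightarrow> 'w set set \<Rightarrow> ('w set \<Rightarrow> real) \<Rightarrow> bool" where
  "signed_measure_space \<Omega> F \<mu> \<longleftrightarrow>
     sigma_algebra \<Omega> F \<and> \<mu> {} = 0 \<and>
     (\<forall>A :: nat \<Rightarrow> 'w set. range A \<subseteq> F \<longrightarrow> disjoint_family A \<longrightarrow>
        (\<lambda>i. \<mu> (A i)) sums \<mu> (\<Union>i. A i))"

definition extended_random_variable ::
    "'w set \<Rightarrow> 'w set set \<Rightarrow> real set \<Rightarrow> ('w \<Rightarrow> real) \<Rightarrow> bool" where
  "extended_random_variable \<Omega> F M R \<longleftrightarrow> R \<in> measurable (sigma \<Omega> F) (restrict_space borel M)"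

text \<open>
  The triple formed by \<open>\<Omega>\<close>, a sub-sigma-algebra of \<open>F\<close>, and the restriction of \<open>\<mu>\<close> to it
  is packaged as a single value \<open>P\<close> of the library type of measures; the sub-sigma-algebra
  is \<open>sets P\<close>. The context is given by the set \<open>N\<close> of indices of its variables.
\<close>

definition context_probability_space ::
    "'w set \<Rightarrow> 'w set set \<Rightarrow> ('w set \<Rightarrow> real) \<Rightarrow> (nat \<Rightarrow> real set) \<Rightarrow> (nat \<Rightarrow> 'w \<Rightarrow> real) \<Rightarrow>
     nat set \<Rightarrow> 'w measure \<Rightarrow> bool" where
  "context_probability_space \<Omega> F \<mu> M R N P \<longleftrightarrow>
     space P = \<Omega> \<and> sets P \<subseteq> F \<and> (\<forall>A\<in>sets P. measure P A = \<mu> A) \<and> prob_space P \<and>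
     (\<forall>k\<in>N. R k \<in> measurable P (restrict_space borel (M k)))"

definition induced_context ::
    "'w set \<Rightarrow> 'w set set \<Rightarrow> ('w set \<Rightarrow> real) \<Rightarrow> nat \<Rightarrow> (nat \<Rightarrow> real set) \<Rightarrow> (nat \<Rightarrow> 'w \<Rightarrow> real) \<Rightarrow>
     nat set \<Rightarrow> bool" where
  "induced_context \<Omega> F \<mu> n M R N \<longleftrightarrow>
     N \<subseteq> {1..n} \<and> (\<exists>P. context_probability_space \<Omega> F \<mu> M R N P)"

text \<open>
  The variables are \<open>R 1, ..., R n\<close>, with \<open>R i\<close> taking values in \<open>M i\<close>; \<open>Cs\<close> is the set of
  contexts with which the signed measure space is endowed.
\<close>

definition signed_probability_space ::
    "'w set \<Rightarrow> 'w set set \<Rightarrow> ('w set \<Rightarrow> real) \<Rightarrow> nat \<Rightarrow> (nat \<Rightarrow> real set) \<Rightarrow> (nat \<Rightarrow> 'w \<Rightarrow> real) \<Rightarrow>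
     nat set set \<Rightarrow> bool" where
  "signed_probability_space \<Omega> F \<mu> n M R Cs \<longleftrightarrow>
     signed_measure_space \<Omega> F \<mu> \<and> \<mu> \<Omega> = 1 \<and>
     (\<forall>i\<in>{1..n}. extended_random_variable \<Omega> F (M i) (R i)) \<and>
     Cs \<noteq> {} \<and> (\<forall>N\<in>Cs. induced_context \<Omega> F \<mu> n M R N)"

abbreviation pm :: "real set" where
  "pm \<equiv> {-1, 1}"

definition joint_distribution :: "(real \<times> real) measure \<Rightarrow> bool" where
  "joint_distribution p \<longleftrightarrow> prob_space p \<and> sets p = Pow (pm \<times> pm)"

definition marginal1 :: "(real \<times> real) measure \<Rightarrow> real \<Rightarrow> real" where
  "marginal1 p a = (\<Sum>b\<in>pm. measure p {(a, b)})"

definition marginal2 :: "(real \<times> real) measure \<Rightarrow> real \<Rightarrow> real" where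
  "marginal2 p b = (\<Sum>a\<in>pm. measure p {(a, b)})"

text \<open>
  A version of a variable in a context is represented by its outcome probabilities there,
  i.e. by the corresponding marginal of the joint distribution.
\<close>

definition indistinguishable :: "(real \<Rightarrow> real) \<Rightarrow> (real \<Rightarrow> real) \<Rightarrow> bool" where
  "indistinguishable f g \<longleftrightarrow> (\<forall>a\<in>pm. f a = g a)"

definition joint_law :: "'w measure \<Rightarrow> ('w \<Rightarrow> real) \<Rightarrow> ('w \<Rightarrow> real) \<Rightarrow> (real \<times> real) measure" where
  "joint_law P U V = distr P (count_space (pm \<times> pm)) (\<lambda>\<omega>. (U \<omega>, V \<omega>))"

end

theory Submission
  imports Defs
begin

text \<open>
  Take \<open>\<Omega> = {-1, 1}\<^sup>3\<close> with the coordinate functions and the signed weight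
  \<open>w(x, y, z) = (pXY(x, y) + pXZ(x, z) + pYZ(y, z)) / 2 - (pX(x) + pY(y) + pZ(z)) / 4 + 1 / 8\<close>,
  where \<open>pX\<close>, \<open>pY\<close>, \<open>pZ\<close> are the marginals; this is the function on \<open>{-1, 1}\<^sup>3\<close> whose Fourier
  coefficients are the prescribed ones in degrees 0, 1, 2 and vanish in degree 3. The
  indistinguishability relations make the marginals well defined, so that summing \<open>w\<close> over one
  coordinate gives the joint distribution of the other two. On the sub-sigma-algebra generated
  by a pair of coordinates the signed measure is therefore the pull-back of that distribution.
\<close>

text \<open>In a finite set a disjoint family has only finitely many nonempty members, so countable
  additivity reduces to finite additivity, whatever the signs of \<open>w\<close>.\<close>

lemma signed_measure_space_sum:
  fixes w :: "'w \<Rightarrow> real"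
  assumes "finite \<Omega>"
  shows "signed_measure_space \<Omega> (Pow \<Omega>) (sum w)"
  unfolding signed_measure_space_def
proof (intro conjI allI impI)
  show "sigma_algebra \<Omega> (Pow \<Omega>)"
    by (rule sigma_algebra_Pow)
  fix A :: "nat \<Rightarrow> 'w set"
  assume A: "range A \<subseteq> Pow \<Omega>" and disj: "disjoint_family A"
  define I where "I = {i. A i \<noteq> {}}"
  have fin: "finite (A i)" for i
    using A assms by (auto intro: finite_subset)
  \<comment> \<open>Two equal nonempty members of the family would not be disjoint.\<close>
  have inj: "inj_on A I"
    using disj by (fastforce simp: inj_on_def I_def disjoint_family_on_def)
  have "finite (A ` I)"
    using A assms by (auto intro: finite_subset[of _ "Pow \<Omega>"])
  then have I: "finite I"
    using inj by (rule finite_imageD)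
  have "(\<lambda>i. sum w (A i)) sums (\<Sum>i\<in>I. sum w (A i))"
    using I by (rule sums_finite) (simp add: I_def)
  also have "(\<Sum>i\<in>I. sum w (A i)) = sum w (\<Union>i\<in>I. A i)"
    using I fin disj by (intro sum.UNION_disjoint[symmetric]) (auto simp: disjoint_family_on_def)
  also have "(\<Union>i\<in>I. A i) = (\<Union>i. A i)"
    by (auto simp: I_def)
  finally show "(\<lambda>i. sum w (A i)) sums sum w (\<Union>i. A i)" .
qed simp

lemma joint_distribution_space:
  assumes "joint_distribution p"
  shows "space p = pm \<times> pm"
proof -
  have "sets p = sets (count_space (pm \<times> pm))"
    using assms by (simp add: joint_distribution_def)
  from sets_eq_imp_space_eq[OF this] show ?thesis
    by simp
qed

lemma joint_distribution_sum:
  assumes "joint_distribution p" and "B \<subseteq> pm \<times> pm"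
  shows "measure p B = (\<Sum>b\<in>B. measure p {b})"
proof -
  interpret prob_space p
    using assms(1) by (simp add: joint_distribution_def)
  have "finite B"
    using assms(2) by (rule finite_subset) simp
  then show ?thesis
    using assms by (intro finite_measure_eq_sum_singleton) (auto simp: joint_distribution_def)
qed

text \<open>Negative values of \<open>w\<close> do no harm here: the sigma-algebra generated by the
  pair sees only sums of \<open>w\<close> over whole fibres, and these are the probabilities given
  by \<open>p\<close>. Surjectivity provides a section of the pair map, so that \<open>p\<close> can
  be carried back to \<open>\<Omega>\<close>.\<close>

lemma context_of_joint_distribution:
  fixes w :: "'w \<Rightarrow> real"
  assumes p: "joint_distribution p"
    and fin: "finite \<Omega>"
    and surj: "(\<lambda>\<omega>. (R i \<omega>, R j \<omega>)) ` \<Omega> = pm \<times> pm"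
    and w: "\<And>b. b \<in> pm \<times> pm \<Longrightarrow> (\<Sum>\<omega> | \<omega> \<in> \<Omega> \<and> (R i \<omega>, R j \<omega>) = b. w \<omega>) = measure p {b}"
  shows "\<exists>P. context_probability_space \<Omega> (Pow \<Omega>) (sum w) (\<lambda>_. pm) R {i, j} P \<and>
             joint_law P (R i) (R j) = p"
proof -
  interpret prob_space p
    using p by (simp add: joint_distribution_def)
  define S :: "(real \<times> real) set" where "S = pm \<times> pm"
  define f where "f \<omega> = (R i \<omega>, R j \<omega>)" for \<omega>
  have sets_p: "sets p = Pow S"
    using p by (simp add: joint_distribution_def S_def)
  have space_p: "space p = S"
    unfolding S_def using p by (rule joint_distribution_space)
  have fim: "f ` \<Omega> = S"
    using surj by (simp add: f_def S_def)
  define g where "g = inv_into \<Omega> f"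
  have g: "g b \<in> \<Omega>" "f (g b) = b" if "b \<in> S" for b
    using that unfolding g_def fim[symmetric] by (auto intro: inv_into_into f_inv_into_f)
  define V where "V = vimage_algebra \<Omega> f p"
  have fV: "f \<in> \<Omega> \<rightarrow> space p"
    using fim space_p by blast
  \<comment> \<open>Measurability into \<open>V\<close> only has to be checked after composing with
    \<open>f\<close>, and \<open>f\<close> after \<open>g\<close> is the identity on
    \<open>S\<close>.\<close>
  have g_meas: "g \<in> measurable p V"
    unfolding V_def using g fV space_p
    by (intro measurable_vimage_algebra2) (auto simp: measurable_def sets_p)
  \<comment> \<open>The law \<open>p\<close> is pulled back along \<open>f\<close> by pushing it forward along the section \<open>g\<close>.\<close>
  define P where "P = distr p V g"
  have space_P: "space P = \<Omega>"
    by (simp add: P_def V_def)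
  have sets_P: "sets P = {f -` B \<inter> \<Omega> | B. B \<subseteq> S}"
    using fV by (auto simp: P_def V_def sets_vimage_algebra2 sets_p)
  have f_meas: "f \<in> measurable P (count_space S)"
    using fim by (auto simp: measurable_def space_P sets_P)
  have "measure P A = sum w A" if A_sets: "A \<in> sets P" for A
  proof -
    obtain B where B: "B \<subseteq> S" and A: "A = f -` B \<inter> \<Omega>"
      using A_sets sets_P by blast
    have "measure P A = measure p (g -` A \<inter> space p)"
      using g_meas A_sets by (simp add: P_def measure_distr)
    also have "g -` A \<inter> space p = B"
      using g B unfolding A space_p by auto
    also have "measure p B = (\<Sum>b\<in>B. measure p {b})"
      using p B[unfolded S_def] by (rule joint_distribution_sum)
    \<comment> \<open>For \<open>b\<close> in \<open>B\<close> the whole fibre of \<open>f\<close>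
      over \<open>b\<close> lies in \<open>A\<close>, so the hypothesis on \<open>w\<close> applies;
      regrouping the fibres then gives the sum over \<open>A\<close>.\<close>
    also have "\<dots> = (\<Sum>b\<in>B. \<Sum>\<omega> | \<omega> \<in> A \<and> f \<omega> = b. w \<omega>)"
    proof (rule sum.cong)
      fix b assume b: "b \<in> B"
      then have "b \<in> pm \<times> pm"
        using B unfolding S_def by blast
      moreover have "{\<omega> \<in> A. f \<omega> = b} = {\<omega> \<in> \<Omega>. (R i \<omega>, R j \<omega>) = b}"
        using b unfolding A by (auto simp: f_def)
      ultimately show "measure p {b} = (\<Sum>\<omega> | \<omega> \<in> A \<and> f \<omega> = b. w \<omega>)"
        by (simp only: w)
    qed simp
    also have "\<dots> = sum w A"
      using fin finite_subset[OF B] by (intro sum.group) (auto simp: A S_def)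
    finally show ?thesis .
  qed
  moreover have "R k \<in> measurable P (restrict_space borel pm)" if "k \<in> {i, j}" for k
  proof -
    have "fst \<in> measurable (count_space S) (restrict_space borel pm)"
      and "snd \<in> measurable (count_space S) (restrict_space borel pm)"
      by (auto simp: space_restrict_space S_def)
    from this[THEN measurable_compose[OF f_meas]] show ?thesis
      using that by (auto simp: f_def)
  qed
  moreover have "prob_space P"
    unfolding P_def using g_meas by (rule prob_space_distr)
  ultimately have "context_probability_space \<Omega> (Pow \<Omega>) (sum w) (\<lambda>_. pm) R {i, j} P"
    using sets_P by (auto simp: context_probability_space_def space_P)
  moreover have "joint_law P (R i) (R j) = p"
  proof -
    have "joint_law P (R i) (R j) = distr P (count_space S) f"
      by (simp add: joint_law_def f_def[abs_def] S_def)
    also have "\<dots> = distr p (count_space S) (f \<circ> g)"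
      using f_meas g_meas unfolding P_def by (subst distr_distr) (auto cong: measurable_cong_sets)
    \<comment> \<open>The section property again: \<open>f \<circ> g\<close> is the identity on
      \<open>S\<close>, and every subset of \<open>S\<close> is measurable for
      \<open>p\<close>.\<close>
    also have "\<dots> = distr p p (\<lambda>b. b)"
      using g space_p sets_p by (intro distr_cong) auto
    finally show ?thesis
      by simp
  qed
  ultimately show ?thesis
    by blast
qed

theorem proposition6:
  fixes pXY pXZ pYZ :: "(real \<times> real) measure"
  assumes "joint_distribution pXY" and "joint_distribution pXZ" and "joint_distribution pYZ"
    and X: "indistinguishable (marginal1 pXY) (marginal1 pXZ)"
    and Y: "indistinguishable (marginal2 pXY) (marginal1 pYZ)"
    and Z: "indistinguishable (marginal2 pXZ) (marginal2 pYZ)"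
  shows "\<exists>(\<Omega> :: (real \<times> real \<times> real) set) F \<mu> R.
           signed_probability_space \<Omega> F \<mu> 3 (\<lambda>_. pm) R {{1, 2}, {1, 3}, {2, 3}} \<and>
           (\<exists>P. context_probability_space \<Omega> F \<mu> (\<lambda>_. pm) R {1, 2} P \<and>
                joint_law P (R 1) (R 2) = pXY) \<and>
           (\<exists>P. context_probability_space \<Omega> F \<mu> (\<lambda>_. pm) R {1, 3} P \<and>
                joint_law P (R 1) (R 3) = pXZ) \<and>
           (\<exists>P. context_probability_space \<Omega> F \<mu> (\<lambda>_. pm) R {2, 3} P \<and>
                joint_law P (R 2) (R 3) = pYZ)"
proof -
  define \<Omega> where "\<Omega> = pm \<times> pm \<times> pm"
  \<comment> \<open>Only the indices 1, 2 and 3 matter; all others default to the third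
    coordinate.\<close>
  define R :: "nat \<Rightarrow> real \<times> real \<times> real \<Rightarrow> real" where
    "R i = (\<lambda>(x, y, z). if i = 1 then x else if i = 2 then y else z)" for i
  define w where
    "w = (\<lambda>(x, y, z). (measure pXY {(x, y)} + measure pXZ {(x, z)} + measure pYZ {(y, z)}) / 2
       - (marginal1 pXY x + marginal2 pXY y + marginal2 pXZ z) / 4 + 1 / 8)"
  have fin: "finite \<Omega>"
    by (simp add: \<Omega>_def)
  have total: "measure p {(-1, -1)} + measure p {(-1, 1)} + measure p {(1, -1)} + measure p {(1, 1)} = 1"
    if "joint_distribution p" for p
  proof -
    interpret prob_space p
      using that by (simp add: joint_distribution_def)
    show ?thesis
      using joint_distribution_sum[OF that, of "pm \<times> pm"] prob_space joint_distribution_space[OF that]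
      by (simp add: insert_Times_insert)
  qed
  note tot = total[OF assms(1)] total[OF assms(2)] total[OF assms(3)]
  \<comment> \<open>Written out on atoms, the indistinguishability relations and the total masses
    turn the three fibre sums below into linear arithmetic.\<close>
  have eqs:
    "measure pXY {(a, -1)} + measure pXY {(a, 1)} = measure pXZ {(a, -1)} + measure pXZ {(a, 1)}"
    "measure pXY {(-1, a)} + measure pXY {(1, a)} = measure pYZ {(a, -1)} + measure pYZ {(a, 1)}"
    "measure pXZ {(-1, a)} + measure pXZ {(1, a)} = measure pYZ {(-1, a)} + measure pYZ {(1, a)}"
    if "a \<in> pm" for a
    using X Y Z that by (auto simp: indistinguishable_def marginal1_def marginal2_def)
  note eqs' = eqs[of 1, simplified] eqs[of "-1", simplified]
  have fibre12: "{\<omega> \<in> \<Omega>. (R 1 \<omega>, R 2 \<omega>) = (a, b)} = {(a, b, -1), (a, b, 1)}"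
    and fibre13: "{\<omega> \<in> \<Omega>. (R 1 \<omega>, R 3 \<omega>) = (a, b)} = {(a, -1, b), (a, 1, b)}"
    and fibre23: "{\<omega> \<in> \<Omega>. (R 2 \<omega>, R 3 \<omega>) = (a, b)} = {(-1, a, b), (1, a, b)}"
    if "a \<in> pm" "b \<in> pm" for a b
    using that by (auto simp: \<Omega>_def R_def)
  have c12: "\<exists>P. context_probability_space \<Omega> (Pow \<Omega>) (sum w) (\<lambda>_. pm) R {1, 2} P \<and>
      joint_law P (R 1) (R 2) = pXY"
  proof (rule context_of_joint_distribution[OF assms(1) fin])
    show "(\<lambda>\<omega>. (R 1 \<omega>, R 2 \<omega>)) ` \<Omega> = pm \<times> pm"
      by (auto simp: \<Omega>_def R_def image_iff)
    fix b :: "real \<times> real" assume "b \<in> pm \<times> pm"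
    then obtain u v where b: "b = (u, v)" and uv: "u \<in> pm" "v \<in> pm"
      by blast
    \<comment> \<open>Summing over z, the terms in \<open>pXZ\<close> and \<open>pYZ\<close>
      contribute half of the marginals of x and y, which the subtracted marginals cancel; the
      marginal of z contributes -1/4, offset by twice 1/8. The other two pairs are
      symmetric.\<close>
    show "(\<Sum>\<omega> | \<omega> \<in> \<Omega> \<and> (R 1 \<omega>, R 2 \<omega>) = b. w \<omega>) = measure pXY {b}"
      unfolding b fibre12[OF uv] using tot eqs' uv
      by (auto simp: w_def marginal1_def marginal2_def field_simps)
  qed
  have c13: "\<exists>P. context_probability_space \<Omega> (Pow \<Omega>) (sum w) (\<lambda>_. pm) R {1, 3} P \<and>
      joint_law P (R 1) (R 3) = pXZ"
  proof (rule context_of_joint_distribution[OF assms(2) fin])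
    show "(\<lambda>\<omega>. (R 1 \<omega>, R 3 \<omega>)) ` \<Omega> = pm \<times> pm"
      by (auto simp: \<Omega>_def R_def image_iff)
    fix b :: "real \<times> real" assume "b \<in> pm \<times> pm"
    then obtain u v where b: "b = (u, v)" and uv: "u \<in> pm" "v \<in> pm"
      by blast
    show "(\<Sum>\<omega> | \<omega> \<in> \<Omega> \<and> (R 1 \<omega>, R 3 \<omega>) = b. w \<omega>) = measure pXZ {b}"
      unfolding b fibre13[OF uv] using tot eqs' uv
      by (auto simp: w_def marginal1_def marginal2_def field_simps)
  qed
  have c23: "\<exists>P. context_probability_space \<Omega> (Pow \<Omega>) (sum w) (\<lambda>_. pm) R {2, 3} P \<and>
      joint_law P (R 2) (R 3) = pYZ"
  proof (rule context_of_joint_distribution[OF assms(3) fin])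
    show "(\<lambda>\<omega>. (R 2 \<omega>, R 3 \<omega>)) ` \<Omega> = pm \<times> pm"
      by (auto simp: \<Omega>_def R_def image_iff)
    fix b :: "real \<times> real" assume "b \<in> pm \<times> pm"
    then obtain u v where b: "b = (u, v)" and uv: "u \<in> pm" "v \<in> pm"
      by blast
    show "(\<Sum>\<omega> | \<omega> \<in> \<Omega> \<and> (R 2 \<omega>, R 3 \<omega>) = b. w \<omega>) = measure pYZ {b}"
      unfolding b fibre23[OF uv] using tot eqs' uv
      by (auto simp: w_def marginal1_def marginal2_def field_simps)
  qed
  have "sum w \<Omega> = 1"
  proof -
    \<comment> \<open>Any context fixes the total mass: \<open>\<Omega>\<close> belongs to its
      sub-sigma-algebra, where \<open>sum w\<close> agrees with a probability measure.\<close>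
    obtain P where "context_probability_space \<Omega> (Pow \<Omega>) (sum w) (\<lambda>_. pm) R {1, 2} P"
      using c12 by blast
    then show ?thesis
      by (metis context_probability_space_def prob_space.prob_space sets.top)
  qed
  moreover have "extended_random_variable \<Omega> (Pow \<Omega>) pm (R i)" for i
    by (auto simp: extended_random_variable_def measurable_def space_restrict_space \<Omega>_def R_def)
  moreover have "induced_context \<Omega> (Pow \<Omega>) (sum w) 3 (\<lambda>_. pm) R N"
    if "N \<in> {{1, 2}, {1, 3}, {2, 3}}" for N
    using that c12 c13 c23 by (auto simp: induced_context_def)
  ultimately have "signed_probability_space \<Omega> (Pow \<Omega>) (sum w) 3 (\<lambda>_. pm) R {{1, 2}, {1, 3}, {2, 3}}"
    using signed_measure_space_sum[OF fin] by (auto simp: signed_probability_space_def)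
  then show ?thesis
    using c12 c13 c23 by blast
qed

end
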